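(* Let $n\ge1$, let $y\in\mathcal{M}_{n,2}$, and let $q\in\mathbb{R}[x_1,\dots,x_n]$ be a quadratic polynomial. Let $E(q)=\{x\in\mathbb{R}^n:q(x)=0\}$ and $S(q)=\{x\in\mathbb{R}^n:q(x)\ge0\}$. (i) Suppose $E(q)\ne\emptyset$. If $M_1(y)\succ0$ and $L_y$ is $E(q)$-positive, then $y$ has an $E(q)$-representing measure. (ii) Suppose $S(q)\ne\emptyset$. If $M_1(y)\succ0$ and $L_y$ is $S(q)$-positive, then $y$ has an $S(q)$-representing measure.
   Context: "Quadratic" means of total degree two. $\mathcal{M}_{n,2}$ is the set of all real families $y=(y_\alpha)_{\alpha\in\mathbb{Z}_+^n,|\alpha|\le2}$, where $|\alpha|=\alpha_1+\cdots+\alpha_n$. $M_1(y)$ is the $(n+1)\times(n+1)$ real symmetric matrix with rows and columns indexed by $\alpha,\beta\in\mathbb{Z}_+^n$, $|\alpha|,|\beta|\le1$, and $(\alpha,\beta)$ entry $y_{\alpha+\beta}$; $\succ0$ means positive definite. $\mathcal{P}_2$ is the space of real polynomials in $x_1,\dots,x_n$ of degree at most $2$, and the Riesz functional $L_y:\mathcal{P}_2\to\mathbb{R}$ is $L_y\big(\sum_{|\alpha|\le2}p_\alpha x^\alpha\big)=\sum_{|\alpha|\le2}p_\alpha y_\alpha$. For closed $K\subseteq\mathbb{R}^n$, $L_y$ is $K$-positive if $L_y(p)\ge0$ for all $p\in\mathcal{P}_2$ with $p|_K\ge0$; a $K$-representing measure for $y$ is a positive Borel measure $\mu$ on $\mathbb{R}^n$,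 supported in $K$, with $y_\alpha=\int x^\alpha\,d\mu(x)$ for all $|\alpha|\le2$. *)

theory Defs
  imports "HOL-Analysis.Analysis" "HOL-Library.Poly_Mapping"
begin

text \<open>
  Exponents \<open>\<alpha> \<in> \<int>\<^sub>+\<^sup>n\<close> are vectors of type \<open>nat ^ 'n\<close> with \<open>n = CARD('n)\<close>, and \<open>\<real>[x\<^sub>1,\<dots>,x\<^sub>n]\<close>
  is the monoid algebra \<open>(nat ^ 'n) \<Rightarrow>\<^sub>0 real\<close>; \<open>Poly_Mapping.lookup p \<alpha>\<close> is the coefficient of \<open>x\<^sup>\<alpha>\<close>.
\<close>

type_synonym 'n mpoly = "(nat ^ 'n) \<Rightarrow>\<^sub>0 real"

definition mdeg :: "nat ^ 'n \<Rightarrow> nat"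
  where "mdeg \<alpha> = (\<Sum>i\<in>UNIV. \<alpha> $ i)"

definition exponents_upto :: "nat \<Rightarrow> (nat ^ 'n) set"
  where "exponents_upto d = {\<alpha>. mdeg \<alpha> \<le> d}"

text \<open>Ensures that sums over \<open>exponents_upto d\<close> are not degenerate sums over an infinite set.\<close>

lemma finite_exponents_upto [simp]: "finite (exponents_upto d :: (nat ^ 'n) set)"
proof -
  have "exponents_upto d \<subseteq> (vec_lambda :: ('n \<Rightarrow> nat) \<Rightarrow> nat ^ 'n) ` (UNIV \<rightarrow>\<^sub>E {..d})"
  proof
    fix \<alpha> :: "nat ^ 'n"
    assume "\<alpha> \<in> exponents_upto d"
    then have deg: "(\<Sum>i\<in>UNIV. \<alpha> $ i) \<le> d"
      by (simp add: exponents_upto_def mdeg_def)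
    have "\<alpha> $ i \<le> d" for i
      using member_le_sum[of i UNIV "\<lambda>i. \<alpha> $ i"] deg by simp
    then show "\<alpha> \<in> vec_lambda ` (UNIV \<rightarrow>\<^sub>E {..d})"
      by (intro image_eqI[where x = "vec_nth \<alpha>"]) auto
  qed
  then show ?thesis
    by (rule finite_subset) (simp add: finite_PiE)
qed

definition monom_eval :: "nat ^ 'n \<Rightarrow> real ^ 'n \<Rightarrow> real"
  where "monom_eval \<alpha> x = (\<Prod>i\<in>UNIV. (x $ i) ^ (\<alpha> $ i))"

definition peval :: "('n::finite) mpoly \<Rightarrow> real ^ 'n \<Rightarrow> real"
  where "peval p x = (\<Sum>\<alpha>\<in>Poly_Mapping.keys p. Poly_Mapping.lookup p \<alpha> * monom_eval \<alpha> x)"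

text \<open>Convention: the zero polynomial has total degree 0.\<close>

definition total_degree :: "('n::finite) mpoly \<Rightarrow> nat"
  where "total_degree p = Max (insert 0 (mdeg ` Poly_Mapping.keys p))"

definition zero_set :: "('n::finite) mpoly \<Rightarrow> (real ^ 'n) set"
  where "zero_set q = {x. peval q x = 0}"

definition nonneg_set :: "('n::finite) mpoly \<Rightarrow> (real ^ 'n) set"
  where "nonneg_set q = {x. peval q x \<ge> 0}"

text \<open>
  A family \<open>(y\<^sub>\<alpha>)\<close> with \<open>|\<alpha>| \<le> 2\<close> is represented by a total function on exponents, of which only the
  values at exponents of degree at most 2 are ever used. Matrices with an index set \<open>I\<close> are
  likewise functions of two indices that are used only on \<open>I\<close>.
\<close>

definition positive_definite_on :: "'a set \<Rightarrow> ('a \<Rightarrow> 'a \<Rightarrow> real) \<Rightarrow> bool"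
  where "positive_definite_on I A \<longleftrightarrow>
    (\<forall>i\<in>I. \<forall>j\<in>I. A i j = A j i) \<and>
    (\<forall>v. (\<exists>i\<in>I. v i \<noteq> 0) \<longrightarrow> (\<Sum>i\<in>I. \<Sum>j\<in>I. v i * A i j * v j) > 0)"

definition moment_matrix :: "(nat ^ 'n \<Rightarrow> real) \<Rightarrow> nat ^ 'n \<Rightarrow> nat ^ 'n \<Rightarrow> real"
  where "moment_matrix y \<alpha> \<beta> = y (\<alpha> + \<beta>)"

definition riesz :: "(nat ^ 'n \<Rightarrow> real) \<Rightarrow> ('n::finite) mpoly \<Rightarrow> real"
  where "riesz y p = (\<Sum>\<alpha>\<in>exponents_upto 2. Poly_Mapping.lookup p \<alpha> * y \<alpha>)"

definition riesz_positive :: "(real ^ 'n) set \<Rightarrow> (nat ^ 'n \<Rightarrow> real) \<Rightarrow> bool"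
  where "riesz_positive K y \<longleftrightarrow>
    (\<forall>p. total_degree p \<le> 2 \<longrightarrow> (\<forall>x\<in>K. peval p x \<ge> 0) \<longrightarrow> riesz y p \<ge> 0)"

text \<open>
  For closed \<open>K\<close>, a Borel measure on \<open>\<real>\<^sup>n\<close> is supported in \<open>K\<close> iff the complement of \<open>K\<close> is a
  null set. Integrability is required explicitly because the Bochner integral of a
  non-integrable function is 0.
\<close>

definition representing_measure ::
    "(real ^ 'n) set \<Rightarrow> (nat ^ 'n \<Rightarrow> real) \<Rightarrow> (real ^ 'n) measure \<Rightarrow> bool"
  where "representing_measure K y \<mu> \<longleftrightarrow>
    sets \<mu> = sets borel \<and> emeasure \<mu> (- K) = 0 \<and>
    (\<forall>\<alpha>\<in>exponents_upto 2. integrable \<mu> (monom_eval \<alpha>) \<and> y \<alpha> = (\<integral>x. monom_eval \<alpha> x \<partial>\<mu>))"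

end

theory Submission
  imports Defs
begin

text \<open>
  Both parts follow from one fact that involves no duality: if \<open>M\<^sub>1(y) \<succ> 0\<close> and \<open>\<lambda> = L(q) / L(1)\<close>,
  then \<open>y\<close> is represented by a finitely atomic measure on the level set \<open>q = \<lambda>\<close>. Positivity on
  \<open>E(q)\<close>, applied to \<open>q\<close> and \<open>- q\<close>, gives \<open>\<lambda> = 0\<close>; positivity on \<open>S(q)\<close>, applied to \<open>q\<close>, gives
  \<open>\<lambda> \<ge> 0\<close>, so that the level set lies in \<open>S(q)\<close>.

  Subtract \<open>\<lambda>\<close> from \<open>q\<close> and normalise to total mass one. Then \<open>y\<close> is given by a mean \<open>m\<close> and a
  matrix \<open>B\<close> of second moments, with \<open>\<Sigma> = B - m m\<^sup>T\<close> positive definite, and the condition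
  \<open>L(q) = 0\<close> reads \<open>q(m) + tr(A \<Sigma>) = 0\<close>, where \<open>A\<close> is the quadratic part of \<open>q\<close>. The goal is
  that \<open>(m, B)\<close> is a convex combination of points \<open>(x, x x\<^sup>T)\<close> with \<open>q(x) = 0\<close>.

  Write \<open>\<Sigma>\<close> as a sum of \<open>r\<close> terms \<open>e\<^sub>i e\<^sub>i\<^sup>T\<close>. Rotating two of the vectors in their plane does not
  change the sum, and it moves the values \<open>e\<^sub>i\<^sup>T A e\<^sub>i\<close> continuously, so all of them can be made equal
  to the same \<open>\<alpha>\<close> (\<open>balanced_decomposition\<close>, the idea of Sturm and Zhang). Then \<open>q(m) = - r \<alpha>\<close>.
  On the line \<open>m + t e\<^sub>i\<close> the polynomial \<open>q\<close> is quadratic in \<open>t\<close>, and if \<open>\<alpha> \<noteq> 0\<close> its two roots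
  have product \<open>- r\<close>. Two atoms at these roots, balanced to have mean \<open>m\<close>, contribute exactly
  \<open>r e\<^sub>i e\<^sub>i\<^sup>T\<close> to the covariance (\<open>two_atoms_on_line\<close>); averaging over \<open>i\<close> gives \<open>(m, B)\<close>.

  There remains the case \<open>\<alpha> = 0\<close>, that is \<open>q(m) = 0\<close>. If the linear part of \<open>q\<close> at \<open>m\<close> vanishes on
  all \<open>e\<^sub>i\<close>, then \<open>q\<close> is zero on these lines and every choice of \<open>t\<close> works. Otherwise a suitable
  mass is split off at a point \<open>m + d\<close> of the quadric with \<open>d\<^sup>T A d \<noteq> 0\<close>. This moves the mean of
  the remainder to a point where \<open>q\<close> is nonzero, and the first case applies
  (\<open>zero_at_mean_in_hull\<close>). Such a \<open>d\<close> exists because the \<open>e\<^sub>i\<close> span the space, by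
  positive definiteness, and because \<open>A \<noteq> 0\<close>: here it matters that the degree of \<open>q\<close> is two.
\<close>

section \<open>Rank-one matrices and balanced decompositions\<close>

definition outer :: "real ^ 'n \<Rightarrow> real ^ 'n \<Rightarrow> real ^ 'n ^ 'n"
  where "outer x y = (\<chi> i j. x $ i * y $ j)"

lemma outer_algebra:
  "outer (x + x') y = outer x y + outer x' y"
  "outer x (y + y') = outer x y + outer x y'"
  "outer (x - x') y = outer x y - outer x' y"
  "outer x (y - y') = outer x y - outer x y'"
  "outer (- x) y = - outer x y"
  "outer x (- y) = - outer x y"
  "outer (c *\<^sub>R x) y = c *\<^sub>R outer x y"
  "outer x (c *\<^sub>R y) = c *\<^sub>R outer x y"
  by (simp_all add: outer_def vec_eq_iff algebra_simps)

lemma outer_sum: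
  "outer (sum f I) y = (\<Sum>i\<in>I. outer (f i) y)"
  "outer y (sum f I) = (\<Sum>i\<in>I. outer y (f i))"
  by (simp_all add: outer_def vec_eq_iff sum_distrib_left sum_distrib_right)

lemma inner_outer: "A \<bullet> outer x y = (\<Sum>i\<in>UNIV. \<Sum>j\<in>UNIV. A $ i $ j * (x $ i * y $ j))"
  by (simp add: inner_vec_def outer_def)

lemma outer_inner_outer: "outer u u \<bullet> outer x x = (u \<bullet> x)\<^sup>2"
  by (simp add: inner_outer inner_vec_def power2_eq_square sum_product outer_def algebra_simps)

lemma inner_outer_axis:
  "A \<bullet> outer (axis i 1) y = A $ i \<bullet> y"
proof -
  have "A \<bullet> outer (axis i 1) y = (\<Sum>k\<in>UNIV. if k = i then A $ i \<bullet> y else 0)"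
    unfolding inner_outer by (intro sum.cong) (auto simp: axis_def inner_vec_def)
  then show ?thesis by simp
qed

lemma inner_outer_commute:
  assumes "transpose A = A"
  shows "A \<bullet> outer x y = A \<bullet> outer y x"
proof -
  have "A $ i $ j = A $ j $ i" for i j
    using assms by (metis transpose_def vec_lambda_beta)
  then have "A \<bullet> outer x y = (\<Sum>i\<in>UNIV. \<Sum>j\<in>UNIV. A $ j $ i * (y $ j * x $ i))"
    unfolding inner_outer by (simp add: mult.commute mult.left_commute)
  also have "\<dots> = A \<bullet> outer y x"
    unfolding inner_outer by (rule sum.swap)
  finally show ?thesis .
qed

text \<open>
  Subtracting \<open>u u\<^sup>T / S\<^sub>j\<^sub>j\<close>, where \<open>u\<close> is the \<open>j\<close>-th row of \<open>S\<close>, clears the row and the column of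
  \<open>j\<close>. The Schur complement that remains is still positive definite on the other indices: its value
  at \<open>x\<close> is the value of \<open>S\<close> at the point where \<open>S\<close> is smallest on the line through \<open>x\<close> in
  direction \<open>j\<close>.
\<close>

lemma pos_def_on_eq_sum_outer:
  fixes S :: "real ^ 'n ^ 'n"
  assumes "finite J" and "transpose S = S"
    and "\<And>k l. k \<notin> J \<or> l \<notin> J \<Longrightarrow> S $ k $ l = 0"
    and "\<And>x. (\<exists>j\<in>J. x $ j \<noteq> 0) \<Longrightarrow> S \<bullet> outer x x > 0"
  shows "\<exists>e. S = (\<Sum>i\<in>J. outer (e i) (e i))"
  using assms
proof (induction J arbitrary: S rule: finite_induct)
  case empty
  then show ?case by (auto simp: vec_eq_iff)
next
  case (insert j J)
  define p where "p = S $ j $ j"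
  define u where "u = S $ j"
  have sym: "S $ k $ l = S $ l $ k" for k l
    using insert.prems(1) by (metis transpose_def vec_lambda_beta)
  have "S \<bullet> outer (axis j 1) (axis j 1) > 0"
    by (rule insert.prems(3)) (auto simp: axis_def)
  then have p: "p > 0"
    by (simp add: inner_outer_axis p_def inner_axis)
  define S' where "S' = S - (1 / p) *\<^sub>R outer u u"
  have S'_nth: "S' $ k $ l = S $ k $ l - S $ j $ k * S $ j $ l / p" for k l
    by (simp add: S'_def outer_def u_def)
  have "\<exists>e. S' = (\<Sum>i\<in>J. outer (e i) (e i))"
  proof (rule insert.IH)
    show "transpose S' = S'"
      by (simp add: vec_eq_iff transpose_def S'_nth sym mult.commute)
    show "S' $ k $ l = 0" if "k \<notin> J \<or> l \<notin> J" for k l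
    proof (cases "k = j \<or> l = j")
      case True
      then show ?thesis using p sym[of k j] sym[of l j] by (auto simp: S'_nth p_def)
    next
      case False
      then show ?thesis using that insert.prems(2) sym by (auto simp: S'_nth)
    qed
    show "S' \<bullet> outer x x > 0" if nz: "\<exists>k\<in>J. x $ k \<noteq> 0" for x
    proof -
      \<comment> \<open>\<open>x'\<close> minimises \<open>S\<close> on the line \<open>x + t axis j 1\<close>.\<close>
      define r where "r = (u \<bullet> x) / p"
      define x' where "x' = x - r *\<^sub>R axis j 1"
      obtain k where k: "k \<in> J" "x $ k \<noteq> 0" using nz by blast
      have "x' $ k \<noteq> 0" using k insert.hyps by (auto simp: x'_def axis_def)
      then have "S \<bullet> outer x' x' > 0" using k by (intro insert.prems(3)) auto
      also have "S \<bullet> outer x' x' = S \<bullet> outer x x - 2 * r * (u \<bullet> x) + r\<^sup>2 * p"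
        using inner_outer_commute[OF insert.prems(1), of x "axis j 1"]
        by (simp add: x'_def outer_algebra inner_diff_right inner_outer_axis u_def p_def inner_axis
            power2_eq_square algebra_simps)
      also have "\<dots> = S' \<bullet> outer x x"
        using p by (simp add: S'_def inner_diff_left outer_inner_outer r_def power2_eq_square)
      finally show ?thesis .
    qed
  qed
  then obtain e where e: "S' = (\<Sum>i\<in>J. outer (e i) (e i))" by blast
  define e' where "e' = e(j := (1 / sqrt p) *\<^sub>R u)"
  have "(\<Sum>i\<in>insert j J. outer (e' i) (e' i)) = outer (e' j) (e' j) + (\<Sum>i\<in>J. outer (e' i) (e' i))"
    using insert.hyps by simp
  also have "(\<Sum>i\<in>J. outer (e' i) (e' i)) = S'"
    unfolding e using insert.hyps by (intro sum.cong) (auto simp: e'_def)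
  also have "outer (e' j) (e' j) = (1 / p) *\<^sub>R outer u u"
    using p by (simp add: e'_def outer_algebra)
  finally show ?case by (intro exI[of _ e']) (simp add: S'_def)
qed

text \<open>
  As long as some value \<open>v\<^sub>i\<^sup>T A v\<^sub>i\<close> differs from the average \<open>\<alpha>\<close>, one value lies above \<open>\<alpha>\<close> and
  another one below. A rotation in the plane of these two vectors keeps the sum of their outer
  products; a quarter turn exchanges them up to sign, so an intermediate angle gives the first one
  the value \<open>\<alpha>\<close>. The number of vectors with the wrong value has then dropped.
\<close>

lemma balanced_decomposition:
  fixes A :: "real ^ 'n ^ 'n" and v :: "'i \<Rightarrow> real ^ 'n" and \<alpha> :: real
  assumes "finite I" "(\<Sum>i\<in>I. A \<bullet> outer (v i) (v i)) = card I * \<alpha>"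
  shows "\<exists>w. (\<Sum>i\<in>I. outer (w i) (w i)) = (\<Sum>i\<in>I. outer (v i) (v i)) \<and>
    (\<forall>i\<in>I. A \<bullet> outer (w i) (w i) = \<alpha>)"
  using assms
proof (induction "card {i\<in>I. A \<bullet> outer (v i) (v i) \<noteq> \<alpha>}" arbitrary: v rule: less_induct)
  case (less v)
  define g where "g x = A \<bullet> outer x x" for x
  show ?case
  proof (cases "\<forall>i\<in>I. g (v i) = \<alpha>")
    case True
    then show ?thesis unfolding g_def by blast
  next
    case False
    have sum0: "(\<Sum>i\<in>I. g (v i) - \<alpha>) = 0"
      using less.prems by (simp add: sum_subtractf g_def)
    have "\<exists>i\<in>I. g (v i) - \<alpha> > 0"
    proof (rule ccontr)
      assume "\<not> ?thesis"
      then have "\<forall>i\<in>I. g (v i) - \<alpha> = 0"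
        using sum_nonneg_eq_0_iff[of I "\<lambda>i. \<alpha> - g (v i)"] sum0 less.prems(1)
        by (simp add: not_less sum_subtractf)
      then show False using False by auto
    qed
    moreover have "\<exists>j\<in>I. g (v j) - \<alpha> < 0"
    proof (rule ccontr)
      assume "\<not> ?thesis"
      then have "\<forall>i\<in>I. g (v i) - \<alpha> = 0"
        using sum_nonneg_eq_0_iff[of I "\<lambda>i. g (v i) - \<alpha>"] sum0 less.prems(1)
        by (simp add: not_less)
      then show False using False by auto
    qed
    ultimately obtain i j where i: "i \<in> I" "g (v i) > \<alpha>" and j: "j \<in> I" "g (v j) < \<alpha>"
      by auto
    then have "i \<noteq> j" by auto
    define w where "w \<theta> = cos \<theta> *\<^sub>R v i + sin \<theta> *\<^sub>R v j" for \<theta>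
    have "\<exists>\<theta>\<ge>0. \<theta> \<le> pi / 2 \<and> g (w \<theta>) = \<alpha>"
    proof (rule IVT2')
      show "g (w (pi / 2)) \<le> \<alpha>" "\<alpha> \<le> g (w 0)"
        using i j by (auto simp: w_def)
      show "continuous_on {0..pi / 2} (\<lambda>\<theta>. g (w \<theta>))"
        unfolding g_def w_def inner_outer by (intro continuous_intros)
    qed auto
    then obtain \<theta> where \<theta>: "g (w \<theta>) = \<alpha>" by blast
    define w' where "w' = cos \<theta> *\<^sub>R v j - sin \<theta> *\<^sub>R v i"
    define v' where "v' = v(i := w \<theta>, j := w')"
    have rot: "outer (w \<theta>) (w \<theta>) + outer w' w' = outer (v i) (v i) + outer (v j) (v j)"
    proof -
      have "cos \<theta> * cos \<theta> + sin \<theta> * sin \<theta> = 1"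
        using sin_cos_squared_add2[of \<theta>] by (simp add: power2_eq_square)
      moreover have "outer (w \<theta>) (w \<theta>) + outer w' w'
          = (cos \<theta> * cos \<theta> + sin \<theta> * sin \<theta>) *\<^sub>R (outer (v i) (v i) + outer (v j) (v j))"
        by (simp add: w_def w'_def outer_algebra algebra_simps del: sin_cos_squared_add3)
      ultimately show ?thesis by simp
    qed
    have split: "sum f I = f i + f j + sum f (I - {i, j})" for f :: "'i \<Rightarrow> real ^ 'n ^ 'n"
      using sum.subset_diff[of "{i, j}" I f] i j \<open>i \<noteq> j\<close> less.prems(1) by simp
    have same: "(\<Sum>k\<in>I. outer (v' k) (v' k)) = (\<Sum>k\<in>I. outer (v k) (v k))"
    proof -
      have "(\<Sum>k\<in>I - {i, j}. outer (v' k) (v' k)) = (\<Sum>k\<in>I - {i, j}. outer (v k) (v k))"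
        by (intro sum.cong) (auto simp: v'_def)
      then show ?thesis
        using rot \<open>i \<noteq> j\<close> by (simp add: split v'_def)
    qed
    have "\<exists>w. (\<Sum>i\<in>I. outer (w i) (w i)) = (\<Sum>i\<in>I. outer (v' i) (v' i)) \<and>
      (\<forall>i\<in>I. A \<bullet> outer (w i) (w i) = \<alpha>)"
    proof (rule less.hyps)
      have "{k\<in>I. A \<bullet> outer (v' k) (v' k) \<noteq> \<alpha>} \<subset> {k\<in>I. A \<bullet> outer (v k) (v k) \<noteq> \<alpha>}"
      proof (rule psubsetI)
        have off: "A \<bullet> outer (v' i) (v' i) = \<alpha>" "k \<noteq> i \<Longrightarrow> k \<noteq> j \<Longrightarrow> v' k = v k" for k
          using \<theta> \<open>i \<noteq> j\<close> by (simp_all add: v'_def g_def)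
        have bad: "A \<bullet> outer (v i) (v i) \<noteq> \<alpha>" "A \<bullet> outer (v j) (v j) \<noteq> \<alpha>"
          using i j by (simp_all add: g_def)
        show "{k\<in>I. A \<bullet> outer (v' k) (v' k) \<noteq> \<alpha>} \<subseteq> {k\<in>I. A \<bullet> outer (v k) (v k) \<noteq> \<alpha>}"
        proof
          fix k assume "k \<in> {k\<in>I. A \<bullet> outer (v' k) (v' k) \<noteq> \<alpha>}"
          then show "k \<in> {k\<in>I. A \<bullet> outer (v k) (v k) \<noteq> \<alpha>}"
            using off(1) off(2)[of k] bad by (cases "k = i \<or> k = j") auto
        qed
        show "{k\<in>I. A \<bullet> outer (v' k) (v' k) \<noteq> \<alpha>} \<noteq> {k\<in>I. A \<bullet> outer (v k) (v k) \<noteq> \<alpha>}"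
          using off(1) bad(1) i(1) by blast
      qed
      then show "card {k\<in>I. A \<bullet> outer (v' k) (v' k) \<noteq> \<alpha>} < card {k\<in>I. A \<bullet> outer (v k) (v k) \<noteq> \<alpha>}"
        by (rule psubset_card_mono[rotated]) (simp add: less.prems(1))
      show "(\<Sum>k\<in>I. A \<bullet> outer (v' k) (v' k)) = card I * \<alpha>"
        using less.prems(2) unfolding inner_sum_right[symmetric] same .
    qed (rule less.prems(1))
    then show ?thesis using same by simp
  qed
qed

section \<open>Barycentres of points on a quadric\<close>

text \<open>
  The moments of degree one and two of the unit mass at \<open>x\<close>. The convex hull of the image of \<open>K\<close>
  consists of the moments of the finitely atomic probability measures on \<open>K\<close>.
\<close>

definition momvec :: "real ^ 'n \<Rightarrow> (real ^ 'n) \<times> (real ^ 'n ^ 'n)"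
  where "momvec x = (x, outer x x)"

definition quad :: "real \<Rightarrow> real ^ 'n \<Rightarrow> real ^ 'n ^ 'n \<Rightarrow> real ^ 'n \<Rightarrow> real"
  where "quad c b A x = c + b \<bullet> x + A \<bullet> outer x x"

text \<open>
  The derivative of the quadratic polynomial at \<open>a\<close>, applied to \<open>x\<close>.
\<close>

definition lin_part :: "real ^ 'n \<Rightarrow> real ^ 'n ^ 'n \<Rightarrow> real ^ 'n \<Rightarrow> real ^ 'n \<Rightarrow> real"
  where "lin_part b A a x = b \<bullet> x + A \<bullet> outer a x + A \<bullet> outer x a"

lemma quad_add: "quad c b A (a + x) = quad c b A a + lin_part b A a x + A \<bullet> outer x x"
  by (simp add: quad_def lin_part_def outer_algebra inner_add_right)

lemma lin_part_linear:
  "lin_part b A a (x + y) = lin_part b A a x + lin_part b A a y"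
  "lin_part b A a (t *\<^sub>R x) = t * lin_part b A a x"
  "lin_part b A a (x - y) = lin_part b A a x - lin_part b A a y"
  "lin_part b A a (- x) = - lin_part b A a x"
  by (simp_all add: lin_part_def outer_algebra inner_add_right inner_diff_right algebra_simps)

text \<open>
  Dividing by the leading coefficient, the polynomial on the line \<open>a + t e\<close> becomes
  \<open>t\<^sup>2 + \<gamma> t - r\<close>, with roots \<open>s < 0 < t\<close>. The weights that give \<open>s\<close> and \<open>t\<close> mean zero give them
  the second moment \<open>- s t = r\<close>, whatever \<open>\<gamma>\<close> is. If the leading coefficient is zero, the
  polynomial is zero on the whole line, and the same two points with \<open>\<gamma> = 0\<close> may be used.
\<close>

lemma two_atoms_on_line:
  fixes r :: real
  assumes r: "r > 0" and q: "quad c b A a = - r * (A \<bullet> outer e e)"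
    and deg: "A \<bullet> outer e e = 0 \<longrightarrow> lin_part b A a e = 0"
  shows "(a, outer a a + r *\<^sub>R outer e e) \<in> convex hull (momvec ` {x. quad c b A x = 0})"
proof -
  define \<alpha> where "\<alpha> = A \<bullet> outer e e"
  obtain \<gamma> where \<gamma>: "lin_part b A a e = \<gamma> * \<alpha>"
    using deg by (cases "\<alpha> = 0") (auto simp: \<alpha>_def intro: that[of "lin_part b A a e / (A \<bullet> outer e e)"])
  define D where "D = sqrt (\<gamma>\<^sup>2 + 4 * r)"
  have D2: "D\<^sup>2 = \<gamma>\<^sup>2 + 4 * r" using r by (simp add: D_def)
  have "\<bar>\<gamma>\<bar> < D"
    unfolding D_def by (rule real_less_rsqrt) (use r in simp)
  define s t where "s = (- \<gamma> - D) / 2" and "t = (- \<gamma> + D) / 2"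
  have st: "s < 0" "0 < t" using \<open>\<bar>\<gamma>\<bar> < D\<close> by (auto simp: s_def t_def)
  have prod: "s * t = - r" using D2 by (simp add: s_def t_def power2_eq_square algebra_simps)
  have "s + t = - \<gamma>" by (simp add: s_def t_def field_simps)
  have zero: "quad c b A (a + z *\<^sub>R e) = 0" if "z = s \<or> z = t" for z
  proof -
    have "(z - s) * (z - t) = 0" using that by auto
    then have "z * z - (s + t) * z + s * t = 0" by (simp add: algebra_simps)
    then have "z * z + \<gamma> * z - r = 0" using prod \<open>s + t = - \<gamma>\<close> by simp
    moreover have "quad c b A (a + z *\<^sub>R e) = \<alpha> * (z * z + \<gamma> * z - r)"
      using q by (simp add: quad_add lin_part_linear \<gamma> outer_algebra \<alpha>_def algebra_simps)
    ultimately show ?thesis by simp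
  qed
  define p where "p = t / (t - s)"
  have p: "0 \<le> p" "0 \<le> 1 - p" using st by (auto simp: p_def field_simps)
  have m1: "p * s + (1 - p) * t = 0" using st by (simp add: p_def field_simps)
  have m2: "p * (s * s) + (1 - p) * (t * t) = r"
  proof -
    have "p * (s * s) + (1 - p) * (t * t) = (p * s + (1 - p) * t) * (s + t) - s * t"
      by (simp add: algebra_simps)
    then show ?thesis using m1 prod by simp
  qed
  have "p *\<^sub>R momvec (a + s *\<^sub>R e) + (1 - p) *\<^sub>R momvec (a + t *\<^sub>R e)
      \<in> convex hull (momvec ` {x. quad c b A x = 0})"
    by (intro convexD[OF convex_convex_hull] hull_inc imageI) (use p zero in auto)
  moreover have "p *\<^sub>R momvec (a + s *\<^sub>R e) + (1 - p) *\<^sub>R momvec (a + t *\<^sub>R e)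
      = (a + (p * s + (1 - p) * t) *\<^sub>R e,
         outer a a + (p * s + (1 - p) * t) *\<^sub>R (outer a e + outer e a)
           + (p * (s * s) + (1 - p) * (t * t)) *\<^sub>R outer e e)"
    by (simp add: momvec_def outer_algebra algebra_simps)
  ultimately show ?thesis by (simp add: m1 m2)
qed

lemma balanced_in_hull:
  fixes e :: "'i::finite \<Rightarrow> real ^ 'n" and \<alpha> :: real
  assumes \<alpha>: "\<And>i. A \<bullet> outer (e i) (e i) = \<alpha>" and q: "quad c b A a + CARD('i) * \<alpha> = 0"
    and deg: "\<alpha> = 0 \<Longrightarrow> \<forall>i. lin_part b A a (e i) = 0"
  shows "(a, outer a a + (\<Sum>i\<in>UNIV. outer (e i) (e i)))
    \<in> convex hull (momvec ` {x. quad c b A x = 0})"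
proof -
  define r where "r = real CARD('i)"
  have r: "r > 0" by (simp add: r_def)
  have "(\<Sum>i\<in>(UNIV :: 'i set). (1 / r) *\<^sub>R (a, outer a a + r *\<^sub>R outer (e i) (e i)))
      \<in> convex hull (momvec ` {x. quad c b A x = 0})"
  proof (rule convex_sum)
    show "(a, outer a a + r *\<^sub>R outer (e i) (e i)) \<in> convex hull (momvec ` {x. quad c b A x = 0})" for i
      by (rule two_atoms_on_line) (use r \<alpha> q deg in \<open>auto simp: r_def\<close>)
  qed (use r in \<open>auto simp: r_def\<close>)
  also have "(\<Sum>i\<in>(UNIV :: 'i set). (1 / r) *\<^sub>R (a, outer a a + r *\<^sub>R outer (e i) (e i)))
      = (a, outer a a + (\<Sum>i\<in>UNIV. outer (e i) (e i)))"
    using r by (simp add: prod_eq_iff fst_sum snd_sum sum.distrib scaleR_add_right sum_constant_scaleR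
        del: sum_constant flip: r_def)
  finally show ?thesis .
qed

lemma nonzero_at_mean_in_hull:
  fixes e :: "'i::finite \<Rightarrow> real ^ 'n"
  assumes q: "quad c b A a + (\<Sum>i\<in>UNIV. A \<bullet> outer (e i) (e i)) = 0" and "quad c b A a \<noteq> 0"
  shows "(a, outer a a + (\<Sum>i\<in>UNIV. outer (e i) (e i)))
    \<in> convex hull (momvec ` {x. quad c b A x = 0})"
proof -
  define \<alpha> where "\<alpha> = (\<Sum>i\<in>UNIV. A \<bullet> outer (e i) (e i)) / CARD('i)"
  obtain w :: "'i \<Rightarrow> real ^ 'n" where
    w: "(\<Sum>i\<in>UNIV. outer (w i) (w i)) = (\<Sum>i\<in>UNIV. outer (e i) (e i))"
       "\<forall>i. A \<bullet> outer (w i) (w i) = \<alpha>"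
    using balanced_decomposition[of UNIV A e \<alpha>] by (auto simp: \<alpha>_def)
  have "(a, outer a a + (\<Sum>i\<in>UNIV. outer (w i) (w i)))
      \<in> convex hull (momvec ` {x. quad c b A x = 0})"
  proof (rule balanced_in_hull[where \<alpha> = \<alpha>])
    show "quad c b A a + CARD('i) * \<alpha> = 0" using q by (simp add: \<alpha>_def)
    then show "\<forall>i. lin_part b A a (w i) = 0" if "\<alpha> = 0" using assms(2) that by simp
  qed (use w in auto)
  then show ?thesis by (simp add: w)
qed

text \<open>
  For \<open>d\<close> in the span of the \<open>e\<^sub>i\<close>, the matrix \<open>\<Sigma> - s d d\<^sup>T\<close> is again an explicit sum of outer
  products. The value \<open>s = 1 / |k|\<^sup>2\<close> makes the cross terms, which are \<open>- 2 s d d\<^sup>T\<close>, and the square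
  term \<open>s\<^sup>2 |k|\<^sup>2 d d\<^sup>T\<close> add up to \<open>- s d d\<^sup>T\<close>.
\<close>

lemma sum_outer_shear:
  fixes e :: "'i::finite \<Rightarrow> real ^ 'n"
  assumes d: "d = (\<Sum>i\<in>UNIV. k i *\<^sub>R e i)" and s: "s * (\<Sum>i\<in>UNIV. (k i)\<^sup>2) = 1"
  shows "(\<Sum>i\<in>UNIV. outer (e i - (s * k i) *\<^sub>R d) (e i - (s * k i) *\<^sub>R d))
    = (\<Sum>i\<in>UNIV. outer (e i) (e i)) - s *\<^sub>R outer d d"
proof -
  have cross: "(\<Sum>i\<in>UNIV. outer (k i *\<^sub>R e i) d) = outer d d"
    "(\<Sum>i\<in>UNIV. outer d (k i *\<^sub>R e i)) = outer d d"
    by (simp_all only: outer_sum[symmetric] d[symmetric])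
  have "(\<Sum>i\<in>UNIV. outer (e i - (s * k i) *\<^sub>R d) (e i - (s * k i) *\<^sub>R d))
      = (\<Sum>i\<in>UNIV. outer (e i) (e i) - s *\<^sub>R outer (k i *\<^sub>R e i) d - s *\<^sub>R outer d (k i *\<^sub>R e i)
          + (s * s * (k i)\<^sup>2) *\<^sub>R outer d d)"
    by (intro sum.cong) (auto simp: outer_algebra algebra_simps power2_eq_square)
  also have "\<dots> = (\<Sum>i\<in>UNIV. outer (e i) (e i)) - s *\<^sub>R outer d d - s *\<^sub>R outer d d
      + (s * (s * (\<Sum>i\<in>UNIV. (k i)\<^sup>2))) *\<^sub>R outer d d"
    by (simp only: sum.distrib sum_subtractf cross scaleR_sum_right[symmetric]
        scaleR_sum_left[symmetric] sum_distrib_left[symmetric] mult.assoc)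
  finally show ?thesis by (simp add: s)
qed

text \<open>
  If the quadric passes through \<open>a\<close>, the line \<open>a + t d\<close> meets it in exactly one other point, and
  this point lies off the cone \<open>x\<^sup>T A x = 0\<close> with apex \<open>a\<close>, if and only if both numbers in the
  conclusion are nonzero. As all \<open>e\<^sub>i\<close> are isotropic but \<open>A \<noteq> 0\<close>, some
  sum \<open>f = e\<^sub>i + e\<^sub>j\<close> is not isotropic. If the linear part vanishes at \<open>f\<close>, one of \<open>f + e\<^sub>m\<close> and
  \<open>f - e\<^sub>m\<close> will do, as the values of the form there average to its value at \<open>f\<close>.
  The result is stated with coefficients since \<open>sum_outer_shear\<close> needs them.
\<close>

lemma exists_atom_off_cone:
  fixes e :: "'i::finite \<Rightarrow> real ^ 'n"
  assumes sym: "transpose A = A" and "A \<noteq> 0"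
    and iso: "\<And>i. A \<bullet> outer (e i) (e i) = 0"
    and sp: "span (range e) = UNIV"
    and l: "lin_part b A a (e m) \<noteq> 0"
  shows "\<exists>k. let d = (\<Sum>i\<in>UNIV. k i *\<^sub>R e i) in
    A \<bullet> outer d d \<noteq> 0 \<and> lin_part b A a d \<noteq> 0"
proof -
  define E where "E k = (\<Sum>i\<in>UNIV. k i *\<^sub>R e i)" for k :: "'i \<Rightarrow> real"
  define \<delta> where "\<delta> i = (\<lambda>j. if j = i then 1 else 0 :: real)" for i :: 'i
  have E_add: "E (\<lambda>i. k i + l i) = E k + E l" for k l
    by (simp add: E_def scaleR_add_left sum.distrib)
  have E_scale: "E (\<lambda>i. t * k i) = t *\<^sub>R E k" for t k
    by (simp add: E_def scaleR_sum_right)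
  have E_delta: "E (\<delta> i) = e i" for i
    by (simp add: E_def \<delta>_def if_distrib[of "\<lambda>c. c *\<^sub>R _"] cong: if_cong)
  have "\<exists>i j. A \<bullet> outer (e i) (e j) \<noteq> 0"
  proof (rule ccontr)
    assume "\<not> ?thesis"
    then have 0: "A \<bullet> outer (e i) (e j) = 0" for i j by blast
    have lin1: "linear (\<lambda>x. A \<bullet> outer x y)" and lin2: "linear (\<lambda>x. A \<bullet> outer y x)" for y
      by (auto intro!: linearI simp: outer_algebra inner_add_right)
    have 1: "A \<bullet> outer x (e j) = 0" for x j
      by (rule linear_eq_0_on_span[OF lin1, of "range e"]) (use 0 sp in auto)
    have 2: "A \<bullet> outer x y = 0" for x y
      by (rule linear_eq_0_on_span[OF lin2, of "range e"]) (use 1 sp in auto)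
    have "A $ i $ j = 0" for i j
      using 2[of "axis i 1" "axis j 1"] by (simp add: inner_outer_axis inner_axis)
    then show False using \<open>A \<noteq> 0\<close> by (simp add: vec_eq_iff)
  qed
  then obtain i j where ij: "A \<bullet> outer (e i) (e j) \<noteq> 0" by blast
  define f where "f = e i + e j"
  have f: "A \<bullet> outer f f \<noteq> 0"
    using ij iso inner_outer_commute[OF sym, of "e j" "e i"]
    by (simp add: f_def outer_algebra inner_add_right)
  have expand: "A \<bullet> outer (f + t *\<^sub>R e m) (f + t *\<^sub>R e m) = A \<bullet> outer f f + 2 * t * (A \<bullet> outer f (e m))" for t
    using iso inner_outer_commute[OF sym, of "e m" f]
    by (simp add: outer_algebra inner_add_right)
  obtain t where "A \<bullet> outer (f + t *\<^sub>R e m) (f + t *\<^sub>R e m) \<noteq> 0" "lin_part b A a (f + t *\<^sub>R e m) \<noteq> 0"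
  proof (cases "lin_part b A a f = 0")
    case False
    then show ?thesis using that[of 0] f by simp
  next
    case True
    then have "lin_part b A a (f + 1 *\<^sub>R e m) \<noteq> 0" "lin_part b A a (f + (-1) *\<^sub>R e m) \<noteq> 0"
      using l by (simp_all add: lin_part_linear)
    moreover have "A \<bullet> outer (f + 1 *\<^sub>R e m) (f + 1 *\<^sub>R e m) \<noteq> 0 \<or>
        A \<bullet> outer (f + (-1) *\<^sub>R e m) (f + (-1) *\<^sub>R e m) \<noteq> 0"
      unfolding expand using f by linarith
    ultimately show ?thesis using that by blast
  qed
  moreover have "f + t *\<^sub>R e m = E (\<lambda>n. (\<delta> i n + \<delta> j n) + t * \<delta> m n)"
    by (simp add: E_add E_scale E_delta f_def)
  ultimately show ?thesis
    by (intro exI[of _ "\<lambda>n. (\<delta> i n + \<delta> j n) + t * \<delta> m n"]) (simp add: E_def Let_def)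
qed

text \<open>
  Put mass \<open>s / (1 + s)\<close> at a point \<open>a + d\<close> of the quadric. The remaining mass \<open>1 / (1 + s)\<close> must
  have mean \<open>a' = a - s d\<close> and covariance \<open>(1 + s) (\<Sigma> - s d d\<^sup>T)\<close>, which is a sum of outer products
  for \<open>s\<close> as in \<open>sum_outer_shear\<close>. The polynomial takes the value \<open>(s\<^sup>2 + s) d\<^sup>T A d \<noteq> 0\<close> at \<open>a'\<close>.
\<close>

lemma zero_at_mean_in_hull:
  fixes e :: "'i::finite \<Rightarrow> real ^ 'n"
  assumes sym: "transpose A = A" and "A \<noteq> 0"
    and sp: "span (range e) = UNIV"
    and iso: "\<And>i. A \<bullet> outer (e i) (e i) = 0"
    and q0: "quad c b A a = 0"
  shows "(a, outer a a + (\<Sum>i\<in>UNIV. outer (e i) (e i)))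
    \<in> convex hull (momvec ` {x. quad c b A x = 0})" (is "?goal \<in> ?H")
proof (cases "\<forall>i. lin_part b A a (e i) = 0")
  case True
  then show ?thesis
    by (intro balanced_in_hull[where \<alpha> = 0]) (use iso q0 in auto)
next
  case False
  then obtain m where "lin_part b A a (e m) \<noteq> 0" by blast
  from exists_atom_off_cone[OF sym \<open>A \<noteq> 0\<close> iso sp this] obtain k0 where
    "let d = (\<Sum>i\<in>UNIV. k0 i *\<^sub>R e i) in A \<bullet> outer d d \<noteq> 0 \<and> lin_part b A a d \<noteq> 0" ..
  then obtain d0 where d0: "d0 = (\<Sum>i\<in>UNIV. k0 i *\<^sub>R e i)"
    "A \<bullet> outer d0 d0 \<noteq> 0" "lin_part b A a d0 \<noteq> 0" by (simp add: Let_def)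
  \<comment> \<open>The nonzero root of the polynomial on the line \<open>a + t d0\<close>.\<close>
  define t where "t = - lin_part b A a d0 / (A \<bullet> outer d0 d0)"
  define d where "d = t *\<^sub>R d0"
  define k where "k i = t * k0 i" for i
  have t: "t \<noteq> 0" using d0 by (simp add: t_def)
  have d: "d = (\<Sum>i\<in>UNIV. k i *\<^sub>R e i)" by (simp add: d_def d0(1) k_def scaleR_sum_right)
  define z where "z = A \<bullet> outer d d"
  have z: "z \<noteq> 0" using t d0 by (simp add: z_def d_def outer_algebra)
  have lz: "lin_part b A a d = - z"
    using d0 by (simp add: z_def d_def outer_algebra lin_part_linear t_def)
  have atom: "quad c b A (a + d) = 0" by (simp add: quad_add q0 lz z_def)
  have "(\<Sum>i\<in>UNIV. (k i)\<^sup>2) \<noteq> 0"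
  proof
    assume "(\<Sum>i\<in>UNIV. (k i)\<^sup>2) = 0"
    then have "\<forall>i. k i = 0" by (simp add: sum_nonneg_eq_0_iff)
    then have "d = 0" by (simp add: d)
    then show False using z by (simp add: z_def outer_def inner_vec_def)
  qed
  then have kpos: "(\<Sum>i\<in>UNIV. (k i)\<^sup>2) > 0" by (simp add: order_less_le sum_nonneg)
  define s where "s = 1 / (\<Sum>i\<in>UNIV. (k i)\<^sup>2)"
  have s: "s > 0" "s * (\<Sum>i\<in>UNIV. (k i)\<^sup>2) = 1" using kpos by (auto simp: s_def)
  define a' where "a' = a - s *\<^sub>R d"
  define e' where "e' i = sqrt (1 + s) *\<^sub>R (e i - (s * k i) *\<^sub>R d)" for i
  define S where "S = (\<Sum>i\<in>UNIV. outer (e i) (e i))"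
  have S': "(\<Sum>i\<in>UNIV. outer (e' i) (e' i)) = (1 + s) *\<^sub>R (S - s *\<^sub>R outer d d)"
    using s unfolding e'_def S_def sum_outer_shear[OF d s(2), symmetric]
    by (simp add: outer_algebra(7,8) scaleR_sum_right)
  have AS: "A \<bullet> S = 0" by (simp add: S_def inner_sum_right iso)
  have qa': "quad c b A a' = (s + s * s) * z"
    using quad_add[of c b A a "- s *\<^sub>R d"]
    by (simp add: a'_def q0 lin_part_linear lz outer_algebra z_def algebra_simps)
  have rest: "(a', outer a' a' + (\<Sum>i\<in>UNIV. outer (e' i) (e' i))) \<in> ?H"
  proof (rule nonzero_at_mean_in_hull)
    have "(\<Sum>i\<in>UNIV. A \<bullet> outer (e' i) (e' i)) = - (s + s * s) * z"
      unfolding inner_sum_right[symmetric] S'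
      by (simp add: inner_diff_right AS z_def algebra_simps)
    then show "quad c b A a' + (\<Sum>i\<in>UNIV. A \<bullet> outer (e' i) (e' i)) = 0" by (simp add: qa' algebra_simps)
    have "s + s * s > 0" using s by (simp add: add_pos_pos)
    then show "quad c b A a' \<noteq> 0" using z by (simp add: qa')
  qed
  have "(1 / (1 + s)) *\<^sub>R (a', outer a' a' + (\<Sum>i\<in>UNIV. outer (e' i) (e' i)))
      + (s / (1 + s)) *\<^sub>R momvec (a + d) \<in> ?H"
    by (intro convexD[OF convex_convex_hull] rest hull_inc imageI)
      (use s atom in \<open>auto simp: field_simps\<close>)
  moreover have "(a', outer a' a' + (\<Sum>i\<in>UNIV. outer (e' i) (e' i))) + s *\<^sub>R momvec (a + d)
      = (1 + s) *\<^sub>R ?goal"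
    unfolding S' S_def[symmetric]
    by (simp add: a'_def momvec_def outer_algebra algebra_simps)
  then have "(1 / (1 + s)) *\<^sub>R (a', outer a' a' + (\<Sum>i\<in>UNIV. outer (e' i) (e' i)))
      + (s / (1 + s)) *\<^sub>R momvec (a + d) = ?goal"
    using s by (metis (no_types, lifting) add_pos_pos divide_inverse less_numeral_extra(1)
        less_irrefl mult.commute mult_1 scaleR_add_right scaleR_scaleR scaleR_one right_inverse)
  ultimately show ?thesis by simp
qed


theorem mean_and_second_moment_in_hull:
  fixes m :: "real ^ 'n" and B :: "real ^ 'n ^ 'n"
  assumes A: "transpose A = A" "A \<noteq> 0" and B: "transpose B = B"
    and pos: "\<And>x. x \<noteq> 0 \<Longrightarrow> (B - outer m m) \<bullet> outer x x > 0"
    and q: "c + b \<bullet> m + A \<bullet> B = 0"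
  shows "(m, B) \<in> convex hull (momvec ` {x. quad c b A x = 0})"
proof -
  have "\<exists>e :: 'n \<Rightarrow> real ^ 'n. B - outer m m = (\<Sum>i\<in>UNIV. outer (e i) (e i))"
  proof (rule pos_def_on_eq_sum_outer)
    show "transpose (B - outer m m) = B - outer m m"
      using B by (simp add: transpose_def outer_def vec_eq_iff mult.commute)
    show "(B - outer m m) \<bullet> outer x x > 0" if "\<exists>j\<in>UNIV. x $ j \<noteq> 0" for x
      using that by (intro pos) auto
  qed auto
  then obtain e :: "'n \<Rightarrow> real ^ 'n" where e: "B - outer m m = (\<Sum>i\<in>UNIV. outer (e i) (e i))" by blast
  have B_eq: "B = outer m m + (\<Sum>i\<in>UNIV. outer (e i) (e i))"
    by (simp flip: e)
  have mean: "quad c b A m + (\<Sum>i\<in>UNIV. A \<bullet> outer (e i) (e i)) = 0"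
    using q by (simp add: quad_def B_eq inner_add_right inner_sum_right)
  show ?thesis
  proof (cases "quad c b A m = 0")
    case False
    then show ?thesis unfolding B_eq by (intro nonzero_at_mean_in_hull mean)
  next
    case True
    then obtain w :: "'n \<Rightarrow> real ^ 'n" where w: "(\<Sum>i\<in>UNIV. outer (w i) (w i)) = B - outer m m"
       "\<forall>i. A \<bullet> outer (w i) (w i) = 0"
      using balanced_decomposition[of UNIV A e 0] mean unfolding e by auto
    have "span (range w) = UNIV"
    proof (rule ccontr)
      assume "span (range w) \<noteq> UNIV"
      then obtain a where a: "a \<noteq> 0" "\<forall>x\<in>span (range w). a \<bullet> x = 0"
        using span_not_UNIV_orthogonal by blast
      have "w i \<bullet> a = 0" for i
        using a(2) span_base[of "w i" "range w"] by (metis inner_commute rangeI)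
      then have "(B - outer m m) \<bullet> outer a a = 0"
        by (simp add: inner_sum_left outer_inner_outer flip: w(1))
      then show False using pos[OF a(1)] by simp
    qed
    then have "(m, outer m m + (\<Sum>i\<in>UNIV. outer (w i) (w i)))
        \<in> convex hull (momvec ` {x. quad c b A x = 0})"
      by (intro zero_at_mean_in_hull) (use A True w(2) in auto)
    then show ?thesis by (simp add: w(1))
  qed
qed

section \<open>Quadratic polynomials and moments in coordinates\<close>

definition unit_exp :: "'n \<Rightarrow> nat ^ 'n"
  where "unit_exp i = axis i 1"

lemma unit_exp_nth: "unit_exp i $ k = (if k = i then 1 else 0)"
  by (simp add: unit_exp_def axis_def)

lemma mdeg_simps [simp]:
  "mdeg (\<alpha> + \<beta>) = mdeg \<alpha> + mdeg \<beta>"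
  "mdeg (unit_exp i) = 1"
  "mdeg \<alpha> = 0 \<longleftrightarrow> \<alpha> = 0"
  by (auto simp: mdeg_def sum.distrib unit_exp_nth vec_eq_iff)

lemma mdeg_SucE:
  assumes "mdeg \<alpha> = Suc d"
  obtains i \<beta> where "\<alpha> = unit_exp i + \<beta>" "mdeg \<beta> = d"
proof -
  have "\<alpha> \<noteq> 0" using assms by (metis mdeg_simps(3) nat.simps(3))
  then obtain i where i: "\<alpha> $ i \<noteq> 0" by (auto simp: vec_eq_iff)
  have eq: "\<alpha> = unit_exp i + (\<alpha> - unit_exp i)"
    using i by (auto simp: vec_eq_iff unit_exp_nth)
  have "mdeg \<alpha> = 1 + mdeg (\<alpha> - unit_exp i)"
    by (subst eq) (simp only: mdeg_simps)
  then show ?thesis using that[OF eq] assms by simp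
qed

lemma mdeg_eq_1E:
  assumes "mdeg \<alpha> = 1"
  obtains i where "\<alpha> = unit_exp i"
proof -
  obtain i \<beta> where "\<alpha> = unit_exp i + \<beta>" "mdeg \<beta> = 0"
    using assms by (auto elim: mdeg_SucE)
  then show ?thesis using that by simp
qed

lemma mdeg_eq_2E:
  assumes "mdeg \<alpha> = 2"
  obtains i j where "\<alpha> = unit_exp i + unit_exp j"
proof -
  obtain i \<beta> where "\<alpha> = unit_exp i + \<beta>" "mdeg \<beta> = 1"
    using assms by (auto elim: mdeg_SucE simp: numeral_2_eq_2)
  then show ?thesis using that by (metis mdeg_eq_1E)
qed

lemma exponents_upto_1_eq: "exponents_upto 1 = insert 0 (range unit_exp)"
proof -
  have "mdeg \<alpha> \<le> 1 \<longleftrightarrow> \<alpha> = 0 \<or> \<alpha> \<in> range unit_exp" for \<alpha> :: "nat ^ 'a"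
  proof -
    have "mdeg \<alpha> \<le> 1 \<longleftrightarrow> mdeg \<alpha> = 0 \<or> mdeg \<alpha> = 1" by linarith
    then show ?thesis by (auto elim: mdeg_eq_1E simp del: One_nat_def)
  qed
  then show ?thesis by (auto simp: exponents_upto_def)
qed

lemma exponents_upto_2_eq:
  "exponents_upto 2 = insert 0 (range unit_exp) \<union> range (\<lambda>(i, j). unit_exp i + unit_exp j)"
proof -
  have "mdeg \<alpha> \<le> 2 \<longleftrightarrow> \<alpha> \<in> exponents_upto 1 \<or> mdeg \<alpha> = 2" for \<alpha> :: "nat ^ 'a"
    unfolding exponents_upto_def by auto
  moreover have "mdeg \<alpha> = 2 \<longleftrightarrow> \<alpha> \<in> range (\<lambda>(i, j). unit_exp i + unit_exp j)" for \<alpha> :: "nat ^ 'a"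
    by (auto elim!: mdeg_eq_2E)
  ultimately show ?thesis
    by (auto simp: exponents_upto_def[of 2] exponents_upto_1_eq simp del: One_nat_def)
qed

lemma inj_unit_exp: "inj (unit_exp :: 'n \<Rightarrow> nat ^ 'n)"
  by (auto simp: inj_def unit_exp_def axis_eq_axis)

lemma unit_exp_neq_0 [simp]: "unit_exp i \<noteq> 0"
  by (simp add: unit_exp_def axis_eq_0_iff)

lemma sum_exponents_upto_1:
  fixes f :: "nat ^ 'n \<Rightarrow> real"
  shows "sum f (exponents_upto 1) = f 0 + (\<Sum>i\<in>UNIV. f (unit_exp i))"
  unfolding exponents_upto_1_eq
  by (subst sum.insert) (auto simp: sum.reindex[OF inj_unit_exp] dest: sym)

lemma unit_exp_add_eq_iff:
  "unit_exp i + unit_exp j = unit_exp k + unit_exp l \<longleftrightarrow> (i = k \<and> j = l) \<or> (i = l \<and> j = k)"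
proof
  assume eq: "unit_exp i + unit_exp j = unit_exp k + unit_exp l"
  have cancel: "m = n" if "unit_exp m = unit_exp n" for m n :: 'a
    using inj_unit_exp that by (rule injD)
  show "(i = k \<and> j = l) \<or> (i = l \<and> j = k)"
  proof (cases "i = k")
    case True
    then show ?thesis using eq cancel by simp
  next
    case False
    have "(unit_exp i + unit_exp j) $ i = (unit_exp k + unit_exp l) $ i" using eq by simp
    then have "i = l" using False by (simp add: unit_exp_nth split: if_split_asm)
    then show ?thesis using eq cancel by (simp add: add.commute)
  qed
qed (elim disjE conjE; simp add: add.commute)

definition linear_coeffs :: "('n::finite) mpoly \<Rightarrow> real ^ 'n"
  where "linear_coeffs p = (\<chi> i. Poly_Mapping.lookup p (unit_exp i))"

text \<open>
  The symmetric matrix of the quadratic part: the coefficient of \<open>x\<^sub>i x\<^sub>j\<close> with \<open>i \<noteq> j\<close> is shared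
  between the entries \<open>(i, j)\<close> and \<open>(j, i)\<close>.
\<close>

definition quadratic_coeffs :: "('n::finite) mpoly \<Rightarrow> real ^ 'n ^ 'n"
  where "quadratic_coeffs p =
    (\<chi> i j. Poly_Mapping.lookup p (unit_exp i + unit_exp j) * (if i = j then 1 else 1 / 2))"

text \<open>
  With \<open>f \<alpha> = x\<^sup>\<alpha>\<close> this computes the value of \<open>p\<close>, and with \<open>f = y\<close> the Riesz functional.
\<close>

lemma sum_exponents_upto_2:
  fixes p :: "('n::finite) mpoly" and f :: "nat ^ 'n \<Rightarrow> real"
  shows "(\<Sum>\<alpha>\<in>exponents_upto 2. Poly_Mapping.lookup p \<alpha> * f \<alpha>) =
    Poly_Mapping.lookup p 0 * f 0
    + linear_coeffs p \<bullet> (\<chi> i. f (unit_exp i))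
    + quadratic_coeffs p \<bullet> (\<chi> i j. f (unit_exp i + unit_exp j))"
proof -
  let ?l = "\<lambda>\<alpha>. Poly_Mapping.lookup p \<alpha> * f \<alpha>"
  let ?g = "\<lambda>(i, j). unit_exp i + unit_exp j :: nat ^ 'n"
  let ?h = "\<lambda>(i, j). quadratic_coeffs p $ i $ j * f (unit_exp i + unit_exp j)"
  have "sum ?l (range ?g) = (\<Sum>\<alpha>\<in>range ?g. sum ?h {x. x \<in> UNIV \<and> ?g x = \<alpha>})"
  proof (rule sum.cong)
    fix \<alpha> assume "\<alpha> \<in> range ?g"
    then obtain i j where \<alpha>: "\<alpha> = unit_exp i + unit_exp j" by auto
    have fib: "{x. x \<in> UNIV \<and> ?g x = \<alpha>} = {(i, j), (j, i)}"
      unfolding \<alpha> by (auto simp: unit_exp_add_eq_iff)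
    show "?l \<alpha> = sum ?h {x. x \<in> UNIV \<and> ?g x = \<alpha>}"
      unfolding fib by (cases "i = j") (auto simp: \<alpha> quadratic_coeffs_def add.commute)
  qed auto
  also have "\<dots> = sum ?h UNIV"
    by (rule sum.image_gen[symmetric]) simp
  also have "\<dots> = quadratic_coeffs p \<bullet> (\<chi> i j. f (unit_exp i + unit_exp j))"
    by (simp add: inner_vec_def sum.cartesian_product)
  finally have deg2: "sum ?l (range ?g) = quadratic_coeffs p \<bullet> (\<chi> i j. f (unit_exp i + unit_exp j))" .
  have "mdeg \<alpha> \<le> 1" if "\<alpha> \<in> insert 0 (range unit_exp)" for \<alpha> :: "nat ^ 'n"
    using that unfolding exponents_upto_1_eq[symmetric] exponents_upto_def by simp
  moreover have "\<not> mdeg \<alpha> \<le> 1" if "\<alpha> \<in> range ?g" for \<alpha> using that by auto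
  ultimately have "insert 0 (range unit_exp) \<inter> range ?g = {}" by blast
  then have "sum ?l (exponents_upto 2) = sum ?l (exponents_upto 1) + sum ?l (range ?g)"
    unfolding exponents_upto_2_eq exponents_upto_1_eq by (intro sum.union_disjoint finite.insertI finite_imageI finite)
  then show ?thesis
    by (simp add: deg2 sum_exponents_upto_1 linear_coeffs_def inner_vec_def del: One_nat_def)
qed

lemma monom_eval_simps [simp]:
  "monom_eval 0 x = 1"
  "monom_eval (unit_exp i) x = x $ i"
  "monom_eval (\<alpha> + \<beta>) x = monom_eval \<alpha> x * monom_eval \<beta> x"
proof -
  have "monom_eval (unit_exp i) x = (\<Prod>k\<in>UNIV. if k = i then x $ i else 1)"
    unfolding monom_eval_def by (intro prod.cong) (auto simp: unit_exp_nth)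
  then show "monom_eval (unit_exp i) x = x $ i" by simp
qed (auto simp: monom_eval_def power_add prod.distrib)

lemma keys_subset_exponents_upto: "Poly_Mapping.keys p \<subseteq> exponents_upto (total_degree p)"
  by (auto simp: exponents_upto_def total_degree_def intro!: Max_ge)

lemma peval_eq_quad:
  assumes "total_degree p \<le> 2"
  shows "peval p x = quad (Poly_Mapping.lookup p 0) (linear_coeffs p) (quadratic_coeffs p) x"
proof -
  have "Poly_Mapping.keys p \<subseteq> exponents_upto 2"
    using keys_subset_exponents_upto[of p] assms by (auto simp: exponents_upto_def)
  then have "peval p x = (\<Sum>\<alpha>\<in>exponents_upto 2. Poly_Mapping.lookup p \<alpha> * monom_eval \<alpha> x)"
    unfolding peval_def by (intro sum.mono_neutral_left) (auto simp: in_keys_iff)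
  then show ?thesis
    by (simp add: sum_exponents_upto_2 quad_def outer_def)
qed

lemma quadratic_coeffs_nonzero:
  assumes "total_degree p = 2"
  shows "quadratic_coeffs p \<noteq> 0"
proof -
  have "total_degree p \<in> insert 0 (mdeg ` Poly_Mapping.keys p)"
    unfolding total_degree_def by (rule Max_in) auto
  then obtain \<alpha> where \<alpha>: "\<alpha> \<in> Poly_Mapping.keys p" "mdeg \<alpha> = 2" using assms by auto
  then obtain i j where "\<alpha> = unit_exp i + unit_exp j" by (auto elim: mdeg_eq_2E)
  then have "quadratic_coeffs p $ i $ j \<noteq> 0"
    using \<alpha> by (auto simp: quadratic_coeffs_def in_keys_iff)
  then show ?thesis by auto
qed

lemma transpose_quadratic_coeffs: "transpose (quadratic_coeffs p) = quadratic_coeffs p"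
  by (simp add: transpose_def quadratic_coeffs_def vec_eq_iff add.commute)

definition mean :: "(nat ^ 'n \<Rightarrow> real) \<Rightarrow> real ^ 'n"
  where "mean y = (\<chi> i. y (unit_exp i) / y 0)"

definition second_moment :: "(nat ^ 'n \<Rightarrow> real) \<Rightarrow> real ^ 'n ^ 'n"
  where "second_moment y = (\<chi> i j. y (unit_exp i + unit_exp j) / y 0)"

lemma riesz_eq:
  assumes "y 0 \<noteq> 0"
  shows "riesz y p = y 0 * (Poly_Mapping.lookup p 0 + linear_coeffs p \<bullet> mean y
    + quadratic_coeffs p \<bullet> second_moment y)"
  using assms
  by (simp add: riesz_def sum_exponents_upto_2 mean_def second_moment_def inner_vec_def
      ring_distribs sum_distrib_left)

lemma transpose_second_moment: "transpose (second_moment y) = second_moment y"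
  by (simp add: transpose_def second_moment_def vec_eq_iff add.commute)

lemma moment_matrix_form:
  "(\<Sum>\<alpha>\<in>exponents_upto 1. \<Sum>\<beta>\<in>exponents_upto 1. v \<alpha> * moment_matrix y \<alpha> \<beta> * v \<beta>) =
    (v 0)\<^sup>2 * y 0 + 2 * v 0 * (\<Sum>i\<in>UNIV. v (unit_exp i) * y (unit_exp i))
    + (\<Sum>i\<in>UNIV. \<Sum>j\<in>UNIV. v (unit_exp i) * v (unit_exp j) * y (unit_exp i + unit_exp j))"
proof -
  have cross: "(\<Sum>i\<in>UNIV. v (unit_exp i) * y (unit_exp i) * v 0)
      = v 0 * (\<Sum>i\<in>UNIV. v (unit_exp i) * y (unit_exp i))"
    "(\<Sum>i\<in>UNIV. v 0 * y (unit_exp i) * v (unit_exp i))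
      = v 0 * (\<Sum>i\<in>UNIV. v (unit_exp i) * y (unit_exp i))"
    by (simp_all add: sum_distrib_left mult_ac)
  have quadratic: "v (unit_exp i) * y (unit_exp i + unit_exp j) * v (unit_exp j)
      = v (unit_exp i) * v (unit_exp j) * y (unit_exp i + unit_exp j)" for i j
    by simp
  show ?thesis
    unfolding sum_exponents_upto_1 moment_matrix_def add_0_left add_0_right sum.distrib cross quadratic
    by (simp add: power2_eq_square)
qed

text \<open>
  For the affine polynomial \<open>v(z) = x \<bullet> (z - m)\<close>, where \<open>m\<close> is the mean, the form of \<open>M\<^sub>1(y)\<close> is
  \<open>L(v\<^sup>2)\<close>, which is the total mass times the variance in direction \<open>x\<close>.
\<close>

lemma positive_definite_moment_matrix:
  fixes y :: "nat ^ ('n::finite) \<Rightarrow> real"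
  assumes "positive_definite_on (exponents_upto 1) (moment_matrix y)"
  shows "y 0 > 0"
    and "x \<noteq> 0 \<Longrightarrow> (second_moment y - outer (mean y) (mean y)) \<bullet> outer x x > 0"
proof -
  have pos: "(\<Sum>\<alpha>\<in>exponents_upto 1. \<Sum>\<beta>\<in>exponents_upto 1. v \<alpha> * moment_matrix y \<alpha> \<beta> * v \<beta>) > 0"
    if "v \<alpha> \<noteq> 0" "\<alpha> \<in> exponents_upto 1" for v \<alpha>
    using assms that unfolding positive_definite_on_def by blast
  show y0: "y 0 > 0"
    using pos[of "\<lambda>\<alpha>. if \<alpha> = 0 then 1 else 0" 0] unfolding moment_matrix_form
    by (simp add: exponents_upto_1_eq del: One_nat_def)
  assume "x \<noteq> 0"
  then obtain i where i: "x $ i \<noteq> 0" by (auto simp: vec_eq_iff)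
  define t where "t = x \<bullet> mean y"
  define v where "v \<alpha> = (if \<alpha> = 0 then - t else (\<Sum>i\<in>UNIV. x $ i * real (\<alpha> $ i)))" for \<alpha> :: "nat ^ 'n"
  have v0: "v 0 = - t" by (simp add: v_def)
  have v1: "v (unit_exp k) = x $ k" for k
  proof -
    have "x $ i * real (unit_exp k $ i) = (if i = k then x $ k else 0)" for i
      by (simp add: unit_exp_nth)
    then show ?thesis by (simp add: v_def)
  qed
  have s1: "(\<Sum>i\<in>UNIV. v (unit_exp i) * y (unit_exp i)) = y 0 * t"
  proof -
    have "v (unit_exp i) * y (unit_exp i) = y 0 * (x $ i * mean y $ i)" for i
      using y0 by (simp add: v1 mean_def)
    then show ?thesis by (simp add: t_def inner_vec_def sum_distrib_left)
  qed
  have s2: "(\<Sum>i\<in>UNIV. \<Sum>j\<in>UNIV. v (unit_exp i) * v (unit_exp j) * y (unit_exp i + unit_exp j))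
      = y 0 * (second_moment y \<bullet> outer x x)"
  proof -
    have "v (unit_exp i) * v (unit_exp j) * y (unit_exp i + unit_exp j)
        = y 0 * (second_moment y $ i $ j * (x $ i * x $ j))" for i j
      using y0 by (simp add: v1 second_moment_def)
    then show ?thesis by (simp add: inner_outer sum_distrib_left)
  qed
  have "0 < (- t)\<^sup>2 * y 0 + 2 * (- t) * (y 0 * t) + y 0 * (second_moment y \<bullet> outer x x)"
    using pos[of v "unit_exp i"] i unfolding moment_matrix_form s1 s2 v0
    by (simp add: v1 exponents_upto_1_eq del: One_nat_def)
  also have "\<dots> = y 0 * ((second_moment y - outer (mean y) (mean y)) \<bullet> outer x x)"
    by (simp add: inner_diff_left outer_inner_outer t_def inner_commute power2_eq_square algebra_simps)
  finally show "(second_moment y - outer (mean y) (mean y)) \<bullet> outer x x > 0"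
    using y0 by (simp add: zero_less_mult_iff)
qed

section \<open>Representing measures\<close>

text \<open>
  The barycentre is a convex combination of finitely many pairs \<open>(x, x x\<^sup>T)\<close>. The weights, scaled
  by the total mass, define a discrete measure on these pairs, and its image under the first
  projection is the required measure.
\<close>

lemma representing_measure_if_in_hull:
  fixes y :: "nat ^ ('n::finite) \<Rightarrow> real"
  assumes y0: "y 0 > 0" and K: "K \<in> sets borel"
    and hull: "(mean y, second_moment y) \<in> convex hull (momvec ` K)"
  shows "\<exists>\<mu>. representing_measure K y \<mu>"
proof -
  obtain S u where S: "finite S" "S \<subseteq> momvec ` K" and u: "\<forall>v\<in>S. 0 \<le> u v" "sum u S = 1"
    and bary: "(\<Sum>v\<in>S. u v *\<^sub>R v) = (mean y, second_moment y)"
    using hull unfolding convex_hull_explicit by blast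
  define P where "P = point_measure S (\<lambda>v. ennreal (y 0 * u v))"
  define \<mu> where "\<mu> = distr P borel (fst :: (real ^ 'n) \<times> (real ^ 'n ^ 'n) \<Rightarrow> real ^ 'n)"
  have fst_meas: "fst \<in> measurable P borel"
    by (simp add: P_def measurable_point_measure_eq1)
  have snd_eq: "snd v = outer (fst v) (fst v)" and fst_in: "fst v \<in> K" if "v \<in> S" for v
    using that S(2) by (auto simp: momvec_def)
  have mono_meas: "monom_eval \<alpha> \<in> borel_measurable borel" for \<alpha> :: "nat ^ 'n"
    unfolding monom_eval_def by measurable
  have integral: "(\<integral>x. monom_eval \<alpha> x \<partial>\<mu>) = y 0 * (\<Sum>v\<in>S. u v * monom_eval \<alpha> (fst v))" for \<alpha>
    unfolding \<mu>_def integral_distr[OF fst_meas mono_meas] unfolding P_def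
    using S(1) u(1) y0
    by (subst lebesgue_integral_point_measure_finite) (auto simp: sum_distrib_left mult.assoc)
  have "representing_measure K y \<mu>"
    unfolding representing_measure_def
  proof (intro conjI ballI)
    show "sets \<mu> = sets borel" by (simp add: \<mu>_def)
    have "fst -` (- K) \<inter> space P = {}"
      using fst_in by (auto simp: P_def space_point_measure)
    then show "emeasure \<mu> (- K) = 0"
      using K unfolding \<mu>_def by (subst emeasure_distr[OF fst_meas]) (auto simp del: vimage_Compl)
    fix \<alpha> :: "nat ^ 'n" assume \<alpha>: "\<alpha> \<in> exponents_upto 2"
    show "integrable \<mu> (monom_eval \<alpha>)"
      unfolding \<mu>_def integrable_distr_eq[OF fst_meas mono_meas] unfolding P_def
      by (rule integrable_point_measure_finite[OF S(1)])
    have m: "mean y $ i = (\<Sum>v\<in>S. u v * fst v $ i)" for i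
      using arg_cong[OF bary, of "\<lambda>v. fst v $ i"] by (simp add: fst_sum)
    have B: "second_moment y $ i $ j = (\<Sum>v\<in>S. u v * (fst v $ i * fst v $ j))" for i j
    proof -
      have "second_moment y $ i $ j = (\<Sum>v\<in>S. u v * snd v $ i $ j)"
        using arg_cong[OF bary, of "\<lambda>v. snd v $ i $ j"] by (simp add: snd_sum)
      also have "\<dots> = (\<Sum>v\<in>S. u v * (fst v $ i * fst v $ j))"
        by (intro sum.cong) (auto simp: snd_eq outer_def)
      finally show ?thesis .
    qed
    consider "\<alpha> = 0" | i where "\<alpha> = unit_exp i" | i j where "\<alpha> = unit_exp i + unit_exp j"
      using \<alpha> by (auto simp: exponents_upto_2_eq)
    then show "y \<alpha> = (\<integral>x. monom_eval \<alpha> x \<partial>\<mu>)"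
    proof cases
      case 1
      show ?thesis unfolding 1 integral by (simp add: u)
    next
      case (2 i)
      show ?thesis using y0 unfolding 2 integral
        by (simp add: m[symmetric]) (simp add: mean_def)
    next
      case (3 i j)
      show ?thesis using y0 unfolding 3 integral
        by (simp add: B[symmetric]) (simp add: second_moment_def)
    qed
  qed
  then show ?thesis ..
qed

lemma peval_measurable [measurable]: "peval q \<in> borel_measurable borel"
  unfolding peval_def monom_eval_def by measurable

text \<open>
  The common core of both parts: subtracting the constant \<open>L(q) / L(1)\<close> keeps the quadratic part
  of \<open>q\<close> and makes the Riesz functional vanish at the polynomial.
\<close>

lemma representing_measure_level_set:
  fixes y :: "nat ^ ('n::finite) \<Rightarrow> real"
  assumes deg: "total_degree q = 2"
    and pd: "positive_definite_on (exponents_upto 1) (moment_matrix y)"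
    and K: "K \<in> sets borel" "\<And>x. peval q x = riesz y q / y 0 \<Longrightarrow> x \<in> K"
  shows "\<exists>\<mu>. representing_measure K y \<mu>"
proof -
  define l where "l = riesz y q / y 0"
  define b A where "b = linear_coeffs q" and "A = quadratic_coeffs q"
  define c where "c = Poly_Mapping.lookup q 0 - l"
  note y = positive_definite_moment_matrix[OF pd]
  have "(mean y, second_moment y) \<in> convex hull (momvec ` {x. quad c b A x = 0})"
  proof (rule mean_and_second_moment_in_hull)
    show "c + b \<bullet> mean y + A \<bullet> second_moment y = 0"
      using y(1) riesz_eq[of y q] by (simp add: c_def b_def A_def l_def)
  qed (use y(2) deg in \<open>auto simp: A_def transpose_quadratic_coeffs quadratic_coeffs_nonzero transpose_second_moment\<close>)
  moreover have "{x. quad c b A x = 0} \<subseteq> K"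
  proof
    fix x assume "x \<in> {x. quad c b A x = 0}"
    then have "peval q x = l" using peval_eq_quad[of q x] deg by (simp add: quad_def c_def b_def A_def)
    then show "x \<in> K" by (intro K) (simp add: l_def)
  qed
  ultimately have "(mean y, second_moment y) \<in> convex hull (momvec ` K)"
    by (meson hull_mono image_mono subsetD)
  then show ?thesis using representing_measure_if_in_hull y(1) K(1) by blast
qed

lemma riesz_zero_if_positive_on_zero_set:
  fixes y :: "nat ^ ('n::finite) \<Rightarrow> real"
  assumes "total_degree q \<le> 2" "riesz_positive (zero_set q) y"
  shows "riesz y q = 0"
proof -
  have "peval (- q) x = - peval q x" for x by (simp add: peval_def sum_negf)
  moreover have "total_degree (- q) = total_degree q" by (simp add: total_degree_def)
  ultimately have "riesz y (- q) \<ge> 0" "riesz y q \<ge> 0"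
    using assms unfolding riesz_positive_def zero_set_def by auto
  moreover have "riesz y (- q) = - riesz y q" by (simp add: riesz_def sum_negf)
  ultimately show ?thesis by simp
qed

theorem corollary4p11:
  fixes y :: "nat ^ 'n \<Rightarrow> real" and q :: "('n::finite) mpoly"
  assumes "total_degree q = 2"
  shows "(zero_set q \<noteq> {} \<longrightarrow>
        positive_definite_on (exponents_upto 1) (moment_matrix y) \<longrightarrow>
        riesz_positive (zero_set q) y \<longrightarrow>
        (\<exists>\<mu>. representing_measure (zero_set q) y \<mu>)) \<and>
      (nonneg_set q \<noteq> {} \<longrightarrow>
        positive_definite_on (exponents_upto 1) (moment_matrix y) \<longrightarrow>
        riesz_positive (nonneg_set q) y \<longrightarrow>
        (\<exists>\<mu>. representing_measure (nonneg_set q) y \<mu>))"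
proof (intro conjI impI)
  assume pd: "positive_definite_on (exponents_upto 1) (moment_matrix y)"
    and pos: "riesz_positive (zero_set q) y"
  have "riesz y q = 0" using riesz_zero_if_positive_on_zero_set[OF _ pos] assms by simp
  then show "\<exists>\<mu>. representing_measure (zero_set q) y \<mu>"
    by (intro representing_measure_level_set[OF assms pd]) (simp_all add: zero_set_def)
next
  assume pd: "positive_definite_on (exponents_upto 1) (moment_matrix y)"
    and pos: "riesz_positive (nonneg_set q) y"
  have "riesz y q \<ge> 0"
    using pos assms unfolding riesz_positive_def nonneg_set_def by simp
  moreover have "y 0 > 0" by (rule positive_definite_moment_matrix(1)[OF pd])
  ultimately have "riesz y q / y 0 \<ge> 0" by simp
  then show "\<exists>\<mu>. representing_measure (nonneg_set q) y \<mu>"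
    by (intro representing_measure_level_set[OF assms pd]) (simp_all add: nonneg_set_def)
qed

end
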